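(* Let $k$ be a cardinal, $I\subseteq\mathrm{Free}(k)$, and let $C=V(I)$ be a closed subset of $\mathrm{Spec}(\mathrm{Free}(k))$. The following are equivalent: (1) $C$ is (homeomorphic to) the spectrum of a local MV-algebra; (2) $C$ has only one closed point; (3) the intersection of $C$ is a primary ideal.
   Context: An MV-algebra is a structure $(A,\oplus,0,\neg)$ such that $(A,\oplus,0)$ is a commutative monoid, $\neg\neg x=x$, $x\oplus\neg 0=\neg 0$ and $\neg(\neg x\oplus y)\oplus y=\neg(\neg y\oplus x)\oplus x$. It is a lattice with $x\vee y=\neg(\neg x\oplus y)\oplus y$ and $x\wedge y=\neg(\neg x\vee\neg y)$; the product is $xy=x\odot y=\neg(\neg x\oplus\neg y)$ and $x^n$ is the $n$-fold product. An ideal is a nonempty downward closed subset closed under $\oplus$; an ideal $P\neq A$ is prime if $x\wedge y\in P$ implies $x\in P$ or $y\in P$. $\mathrm{Spec}(A)$ is the set of prime ideals with the Zariski topology generated by the open sets $\{P : a\notin P\}$, $a\in A$; $V(I)=\{P\in\mathrm{Spec}(A) : I\subseteq P\}$. $\mathrm{Free}(k)$ is the free MV-algebra over $k$ generators. An MV-algebra is local if it has only one maximal ideal (which then coincides with the set of elements $a$ such that $na\neq 1$ for all $n\in\mathbb N$). A primary ideal is an ideal $J$ such that if $xy\in J$, then $x^n\in J$ or $y^n\in J$ for some $n\in\mathbb N$, $n\geq 1$. The intersection of $C$ means $\bigcap_{P\in C}P$.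
   Formalization: Primary ideals are required to be proper; without this the equivalence fails for empty C (e.g. I = Free(k)), where the intersection of C is Free(k), which is primary as literally defined, while C has no closed point and is not the spectrum of a local MV-algebra. *)

theory Defs
  imports "HOL-Algebra.Group" "HOL-Analysis.Abstract_Topology"
begin
record 'a mv_algebra = "'a partial_object" +
  mv_plus :: "'a \<Rightarrow> 'a \<Rightarrow> 'a" (infixl "\<oplus>\<index>" 65)
  mv_zero :: 'a ("\<zero>\<index>")
  mv_neg :: "'a \<Rightarrow> 'a" ("\<sim>\<index> _" [81] 80)

locale mv_algebra =
  fixes A :: "'a mv_algebra" (structure)
  assumes comm_monoid: "comm_monoid \<lparr>carrier = carrier A, monoid.mult = mv_plus A, one = \<zero>\<rparr>"
    and neg_closed: "x \<in> carrier A \<Longrightarrow> \<sim> x \<in> carrier A"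
    and neg_neg: "x \<in> carrier A \<Longrightarrow> \<sim> (\<sim> x) = x"
    and plus_neg_zero: "x \<in> carrier A \<Longrightarrow> x \<oplus> \<sim> \<zero> = \<sim> \<zero>"
    and lukasiewicz: "\<lbrakk>x \<in> carrier A; y \<in> carrier A\<rbrakk> \<Longrightarrow>
      \<sim> (\<sim> x \<oplus> y) \<oplus> y = \<sim> (\<sim> y \<oplus> x) \<oplus> x"

definition mv_join :: "'a mv_algebra \<Rightarrow> 'a \<Rightarrow> 'a \<Rightarrow> 'a" where
  "mv_join A x y = \<sim>\<^bsub>A\<^esub> (\<sim>\<^bsub>A\<^esub> x \<oplus>\<^bsub>A\<^esub> y) \<oplus>\<^bsub>A\<^esub> y"

definition mv_meet :: "'a mv_algebra \<Rightarrow> 'a \<Rightarrow> 'a \<Rightarrow> 'a" where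
  "mv_meet A x y = \<sim>\<^bsub>A\<^esub> (mv_join A (\<sim>\<^bsub>A\<^esub> x) (\<sim>\<^bsub>A\<^esub> y))"

definition mv_le :: "'a mv_algebra \<Rightarrow> 'a \<Rightarrow> 'a \<Rightarrow> bool" where
  "mv_le A x y \<longleftrightarrow> mv_join A x y = y"

definition mv_prod :: "'a mv_algebra \<Rightarrow> 'a \<Rightarrow> 'a \<Rightarrow> 'a" where
  "mv_prod A x y = \<sim>\<^bsub>A\<^esub> (\<sim>\<^bsub>A\<^esub> x \<oplus>\<^bsub>A\<^esub> \<sim>\<^bsub>A\<^esub> y)"

primrec mv_pow :: "'a mv_algebra \<Rightarrow> 'a \<Rightarrow> nat \<Rightarrow> 'a" where
  "mv_pow A x 0 = \<sim>\<^bsub>A\<^esub> \<zero>\<^bsub>A\<^esub>"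
| "mv_pow A x (Suc n) = mv_prod A (mv_pow A x n) x"

definition mv_ideal :: "'a mv_algebra \<Rightarrow> 'a set \<Rightarrow> bool" where
  "mv_ideal A J \<longleftrightarrow> J \<subseteq> carrier A \<and> J \<noteq> {} \<and>
     (\<forall>x\<in>carrier A. \<forall>y\<in>J. mv_le A x y \<longrightarrow> x \<in> J) \<and>
     (\<forall>x\<in>J. \<forall>y\<in>J. x \<oplus>\<^bsub>A\<^esub> y \<in> J)"

definition mv_prime :: "'a mv_algebra \<Rightarrow> 'a set \<Rightarrow> bool" where
  "mv_prime A P \<longleftrightarrow> mv_ideal A P \<and> P \<noteq> carrier A \<and>
     (\<forall>x\<in>carrier A. \<forall>y\<in>carrier A. mv_meet A x y \<in> P \<longrightarrow> x \<in> P \<or> y \<in> P)"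

definition mv_maximal :: "'a mv_algebra \<Rightarrow> 'a set \<Rightarrow> bool" where
  "mv_maximal A M \<longleftrightarrow> mv_ideal A M \<and> M \<noteq> carrier A \<and>
     (\<forall>J. mv_ideal A J \<and> M \<subseteq> J \<and> J \<noteq> carrier A \<longrightarrow> J = M)"

text \<open>Primary ideals are proper by definition. Without this, the improper ideal would be
  primary; it is the intersection of the empty closed set, which has no closed point.\<close>

definition mv_primary :: "'a mv_algebra \<Rightarrow> 'a set \<Rightarrow> bool" where
  "mv_primary A J \<longleftrightarrow> mv_ideal A J \<and> J \<noteq> carrier A \<and>
     (\<forall>x\<in>carrier A. \<forall>y\<in>carrier A. mv_prod A x y \<in> J \<longrightarrow>
        (\<exists>n\<ge>1. mv_pow A x n \<in> J \<or> mv_pow A y n \<in> J))"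

definition mv_local :: "'a mv_algebra \<Rightarrow> bool" where
  "mv_local A \<longleftrightarrow> mv_algebra A \<and> (\<exists>!M. mv_maximal A M)"

definition mv_Spec :: "'a mv_algebra \<Rightarrow> 'a set set" where
  "mv_Spec A = {P. mv_prime A P}"

definition mv_zariski :: "'a mv_algebra \<Rightarrow> 'a set topology" where
  "mv_zariski A = topology_generated_by {{P \<in> mv_Spec A. a \<notin> P} |a. a \<in> carrier A}"

definition mv_V :: "'a mv_algebra \<Rightarrow> 'a set \<Rightarrow> 'a set set" where
  "mv_V A I = {P \<in> mv_Spec A. I \<subseteq> P}"

text \<open>The intersection is taken inside the carrier, so that the empty family has
  intersection \<^term>\<open>carrier A\<close>.\<close>

definition mv_Inter :: "'a mv_algebra \<Rightarrow> 'a set set \<Rightarrow> 'a set" where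
  "mv_Inter A C = carrier A \<inter> \<Inter>C"

lemma topspace_mv_zariski: "topspace (mv_zariski A) = mv_Spec A"
proof -
  have "\<exists>a\<in>carrier A. a \<notin> P" if "P \<in> mv_Spec A" for P
    using that by (auto simp: mv_Spec_def mv_prime_def mv_ideal_def)
  then show ?thesis
    unfolding mv_zariski_def topology_generated_by_topspace by blast
qed

text \<open>The free MV-algebra over a set \<open>K\<close> of generators is the set of terms with variables
  in \<open>K\<close> modulo equational consequence of the axioms. As \<open>K\<close> is a set rather than
  a type, the empty set of generators is included.\<close>

datatype 'k mv_term = Var 'k | Zero | Plus "'k mv_term" "'k mv_term" | Neg "'k mv_term"

inductive mv_eq :: "'k mv_term \<Rightarrow> 'k mv_term \<Rightarrow> bool" where
  refl: "mv_eq s s"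
| sym: "mv_eq s t \<Longrightarrow> mv_eq t s"
| trans: "mv_eq s t \<Longrightarrow> mv_eq t u \<Longrightarrow> mv_eq s u"
| cong_plus: "mv_eq s s' \<Longrightarrow> mv_eq t t' \<Longrightarrow> mv_eq (Plus s t) (Plus s' t')"
| cong_neg: "mv_eq s s' \<Longrightarrow> mv_eq (Neg s) (Neg s')"
| assoc: "mv_eq (Plus (Plus s t) u) (Plus s (Plus t u))"
| comm: "mv_eq (Plus s t) (Plus t s)"
| zero: "mv_eq (Plus s Zero) s"
| neg_neg: "mv_eq (Neg (Neg s)) s"
| plus_neg_zero: "mv_eq (Plus s (Neg Zero)) (Neg Zero)"
| lukasiewicz: "mv_eq (Plus (Neg (Plus (Neg s) t)) t) (Plus (Neg (Plus (Neg t) s)) s)"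

definition mv_terms :: "'k set \<Rightarrow> 'k mv_term set" where
  "mv_terms K = {t. set_mv_term t \<subseteq> K}"

definition mv_eq_on :: "'k set \<Rightarrow> ('k mv_term \<times> 'k mv_term) set" where
  "mv_eq_on K = {(s, t). s \<in> mv_terms K \<and> t \<in> mv_terms K \<and> mv_eq s t}"

definition free_mv :: "'k set \<Rightarrow> 'k mv_term set mv_algebra" where
  "free_mv K = \<lparr>carrier = mv_terms K // mv_eq_on K,
     mv_plus = (\<lambda>X Y. \<Union>s\<in>X. \<Union>t\<in>Y. mv_eq_on K `` {Plus s t}),
     mv_zero = mv_eq_on K `` {Zero},
     mv_neg = (\<lambda>X. \<Union>s\<in>X. mv_eq_on K `` {Neg s})\<rparr>"

definition free_mv_gen :: "'k set \<Rightarrow> 'k \<Rightarrow> 'k mv_term set" where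
  "free_mv_gen K x = mv_eq_on K `` {Var x}"

lemma mv_terms_simps [simp]:
  "Var x \<in> mv_terms K \<longleftrightarrow> x \<in> K" "Zero \<in> mv_terms K"
  "Plus s t \<in> mv_terms K \<longleftrightarrow> s \<in> mv_terms K \<and> t \<in> mv_terms K"
  "Neg s \<in> mv_terms K \<longleftrightarrow> s \<in> mv_terms K"
  by (auto simp: mv_terms_def)

lemma equiv_mv_eq_on: "equiv (mv_terms K) (mv_eq_on K)"
  by (rule equivI)
     (auto simp: mv_eq_on_def refl_on_def sym_def trans_def mv_eq.refl
        dest: mv_eq.sym mv_eq.trans)

lemma mv_class_eq:
  "mv_eq s t \<Longrightarrow> s \<in> mv_terms K \<Longrightarrow> t \<in> mv_terms K \<Longrightarrow> mv_eq_on K `` {s} = mv_eq_on K `` {t}"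
  by (rule equiv_class_eq[OF equiv_mv_eq_on]) (simp add: mv_eq_on_def)

lemma free_mv_simps:
  "carrier (free_mv K) = mv_terms K // mv_eq_on K"
  "\<zero>\<^bsub>free_mv K\<^esub> = mv_eq_on K `` {Zero}"
  by (simp_all add: free_mv_def)

lemma free_mv_plus:
  assumes "s \<in> mv_terms K" "t \<in> mv_terms K"
  shows "(mv_eq_on K `` {s}) \<oplus>\<^bsub>free_mv K\<^esub> (mv_eq_on K `` {t}) = mv_eq_on K `` {Plus s t}"
proof -
  have "congruent2 (mv_eq_on K) (mv_eq_on K) (\<lambda>s t. mv_eq_on K `` {Plus s t})"
    by (intro congruent2I' mv_class_eq mv_eq.cong_plus) (simp_all add: mv_eq_on_def)
  from UN_equiv_class2[OF equiv_mv_eq_on equiv_mv_eq_on this assms]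
  show ?thesis by (simp add: free_mv_def)
qed

lemma free_mv_neg:
  assumes "s \<in> mv_terms K"
  shows "\<sim>\<^bsub>free_mv K\<^esub> (mv_eq_on K `` {s}) = mv_eq_on K `` {Neg s}"
proof -
  have "congruent (mv_eq_on K) (\<lambda>s. mv_eq_on K `` {Neg s})"
    by (intro congruentI mv_class_eq mv_eq.cong_neg) (simp_all add: mv_eq_on_def)
  from UN_equiv_class[OF equiv_mv_eq_on this assms]
  show ?thesis by (simp add: free_mv_def)
qed

lemma free_mv_cases:
  assumes "X \<in> carrier (free_mv K)"
  obtains s where "s \<in> mv_terms K" "X = mv_eq_on K `` {s}"
  using assms by (auto simp: free_mv_simps elim: quotientE)

lemma free_mv_closed:
  "s \<in> mv_terms K \<Longrightarrow> mv_eq_on K `` {s} \<in> carrier (free_mv K)"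
  by (simp add: free_mv_simps quotientI)

lemma mv_algebra_free_mv: "mv_algebra (free_mv K)"
proof (rule mv_algebra.intro)
  let ?F = "free_mv K"
  show "comm_monoid \<lparr>carrier = carrier ?F, monoid.mult = mv_plus ?F, one = \<zero>\<^bsub>?F\<^esub>\<rparr>"
  proof (rule comm_monoidI, goal_cases)
    case (3 X Y Z)
    then show ?case
      by (simp, elim free_mv_cases) (simp add: free_mv_plus mv_class_eq mv_eq.assoc)
  next
    case (4 X)
    then show ?case
      by (simp, elim free_mv_cases)
         (simp add: free_mv_plus free_mv_simps(2) mv_class_eq mv_eq.trans[OF mv_eq.comm mv_eq.zero])
  next
    case (5 X Y)
    then show ?case
      by (simp, elim free_mv_cases) (simp add: free_mv_plus mv_class_eq mv_eq.comm)
  qed (auto elim!: free_mv_cases simp: free_mv_plus free_mv_closed free_mv_simps(2))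
  fix X Y
  assume X: "X \<in> carrier ?F"
  show "\<sim>\<^bsub>?F\<^esub> X \<in> carrier ?F"
    using X by (elim free_mv_cases) (simp add: free_mv_neg free_mv_closed)
  show "\<sim>\<^bsub>?F\<^esub> (\<sim>\<^bsub>?F\<^esub> X) = X"
    using X by (elim free_mv_cases) (simp add: free_mv_neg mv_class_eq mv_eq.neg_neg)
  show "X \<oplus>\<^bsub>?F\<^esub> \<sim>\<^bsub>?F\<^esub> \<zero>\<^bsub>?F\<^esub> = \<sim>\<^bsub>?F\<^esub> \<zero>\<^bsub>?F\<^esub>"
    using X by (elim free_mv_cases)
      (simp add: free_mv_plus free_mv_neg free_mv_simps(2) mv_class_eq mv_eq.plus_neg_zero)
  assume Y: "Y \<in> carrier ?F"
  show "\<sim>\<^bsub>?F\<^esub> (\<sim>\<^bsub>?F\<^esub> X \<oplus>\<^bsub>?F\<^esub> Y) \<oplus>\<^bsub>?F\<^esub> Y = \<sim>\<^bsub>?F\<^esub> (\<sim>\<^bsub>?F\<^esub> Y \<oplus>\<^bsub>?F\<^esub> X) \<oplus>\<^bsub>?F\<^esub> X"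
    using X Y by (elim free_mv_cases)
      (simp add: free_mv_plus free_mv_neg mv_class_eq mv_eq.lukasiewicz)
qed

definition mv_hom :: "'a mv_algebra \<Rightarrow> 'b mv_algebra \<Rightarrow> ('a \<Rightarrow> 'b) set" where
  "mv_hom A B = {h \<in> carrier A \<rightarrow> carrier B.
     (\<forall>x\<in>carrier A. \<forall>y\<in>carrier A. h (x \<oplus>\<^bsub>A\<^esub> y) = h x \<oplus>\<^bsub>B\<^esub> h y) \<and>
     h \<zero>\<^bsub>A\<^esub> = \<zero>\<^bsub>B\<^esub> \<and> (\<forall>x\<in>carrier A. h (\<sim>\<^bsub>A\<^esub> x) = \<sim>\<^bsub>B\<^esub> (h x))}"

primrec mv_interp :: "'b mv_algebra \<Rightarrow> ('k \<Rightarrow> 'b) \<Rightarrow> 'k mv_term \<Rightarrow> 'b" where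
  "mv_interp B f (Var x) = f x"
| "mv_interp B f Zero = \<zero>\<^bsub>B\<^esub>"
| "mv_interp B f (Plus s t) = mv_interp B f s \<oplus>\<^bsub>B\<^esub> mv_interp B f t"
| "mv_interp B f (Neg s) = \<sim>\<^bsub>B\<^esub> (mv_interp B f s)"

context mv_algebra
begin

lemma zero_closed: "\<zero> \<in> carrier A"
  using comm_monoid.axioms(1)[OF comm_monoid] monoid.one_closed by fastforce

lemma plus_closed: "x \<in> carrier A \<Longrightarrow> y \<in> carrier A \<Longrightarrow> x \<oplus> y \<in> carrier A"
  using comm_monoid.axioms(1)[OF comm_monoid] monoid.m_closed by fastforce

lemma plus_assoc:
  "x \<in> carrier A \<Longrightarrow> y \<in> carrier A \<Longrightarrow> z \<in> carrier A \<Longrightarrow> (x \<oplus> y) \<oplus> z = x \<oplus> (y \<oplus> z)"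
  using monoid.m_assoc[OF comm_monoid.axioms(1)[OF comm_monoid]] by simp

lemma plus_comm: "x \<in> carrier A \<Longrightarrow> y \<in> carrier A \<Longrightarrow> x \<oplus> y = y \<oplus> x"
  using comm_monoid.m_comm[OF comm_monoid] by simp

lemma plus_zero: "x \<in> carrier A \<Longrightarrow> x \<oplus> \<zero> = x"
  using monoid.r_one[OF comm_monoid.axioms(1)[OF comm_monoid]] by simp

lemma mv_interp_closed: "(\<And>x. f x \<in> carrier A) \<Longrightarrow> mv_interp A f t \<in> carrier A"
  by (induction t) (auto intro: zero_closed plus_closed neg_closed)

lemma mv_interp_eq:
  assumes "mv_eq s t" and f: "\<And>x. f x \<in> carrier A"
  shows "mv_interp A f s = mv_interp A f t"
  using assms(1)
proof induction
  case (assoc s t u)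
  show ?case by (simp add: plus_assoc mv_interp_closed[of f, OF f])
next
  case (comm s t)
  show ?case unfolding mv_interp.simps by (intro plus_comm mv_interp_closed f)
next
  case (lukasiewicz s t)
  show ?case
    unfolding mv_interp.simps
    by (intro mv_algebra.lukasiewicz[OF mv_algebra_axioms] mv_interp_closed f)
qed (simp_all add: mv_interp_closed[of f, OF f] plus_zero neg_neg plus_neg_zero)

end

lemma free_mv_universal:
  assumes B: "mv_algebra B" and f: "f \<in> K \<rightarrow> carrier B"
  shows "\<exists>!h. h \<in> extensional (carrier (free_mv K)) \<and> h \<in> mv_hom (free_mv K) B \<and>
    (\<forall>x\<in>K. h (free_mv_gen K x) = f x)"
proof (rule ex_ex1I)
  interpret B: mv_algebra B by (rule B)
  define g where "g x = (if x \<in> K then f x else \<zero>\<^bsub>B\<^esub>)" for x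
  have g: "g x \<in> carrier B" for x
    using f B.zero_closed by (auto simp: g_def)
  define h where "h = (\<lambda>X\<in>carrier (free_mv K). mv_interp B g (SOME s. s \<in> X))"
  have h: "h (mv_eq_on K `` {s}) = mv_interp B g s" if s: "s \<in> mv_terms K" for s
  proof -
    have "s \<in> mv_eq_on K `` {s}"
      using s by (simp add: mv_eq_on_def mv_eq.refl)
    then have "(SOME t. t \<in> mv_eq_on K `` {s}) \<in> mv_eq_on K `` {s}"
      by (rule someI)
    moreover have "mv_eq s t" if "t \<in> mv_eq_on K `` {s}" for t
      using that by (simp add: mv_eq_on_def)
    ultimately have "mv_interp B g (SOME t. t \<in> mv_eq_on K `` {s}) = mv_interp B g s"
      by (intro B.mv_interp_eq[symmetric] g) blast
    then show ?thesis
      using free_mv_closed[OF s] by (simp add: h_def)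
  qed
  have "h \<in> mv_hom (free_mv K) B"
    unfolding mv_hom_def
    by (auto elim!: free_mv_cases simp: h free_mv_plus free_mv_neg free_mv_simps(2)
        B.mv_interp_closed[of g, OF g])
  moreover have "h \<in> extensional (carrier (free_mv K))"
    by (simp add: h_def)
  moreover have "\<forall>x\<in>K. h (free_mv_gen K x) = f x"
    by (simp add: free_mv_gen_def h g_def)
  ultimately show "\<exists>h. h \<in> extensional (carrier (free_mv K)) \<and> h \<in> mv_hom (free_mv K) B \<and>
      (\<forall>x\<in>K. h (free_mv_gen K x) = f x)" by blast
next
  fix h h'
  assume h: "h \<in> extensional (carrier (free_mv K)) \<and> h \<in> mv_hom (free_mv K) B \<and>
      (\<forall>x\<in>K. h (free_mv_gen K x) = f x)"
    and h': "h' \<in> extensional (carrier (free_mv K)) \<and> h' \<in> mv_hom (free_mv K) B \<and>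
      (\<forall>x\<in>K. h' (free_mv_gen K x) = f x)"
  have eq: "h (mv_eq_on K `` {s}) = h' (mv_eq_on K `` {s})" if "s \<in> mv_terms K" for s
    using that
  proof (induction s)
    case (Var x)
    then show ?case using h h' by (simp add: free_mv_gen_def)
  next
    case Zero
    then show ?case using h h' by (simp add: mv_hom_def flip: free_mv_simps(2))
  next
    case (Plus s t)
    then show ?case using h h' by (simp add: mv_hom_def free_mv_closed flip: free_mv_plus)
  next
    case (Neg s)
    then show ?case using h h' by (simp add: mv_hom_def free_mv_closed flip: free_mv_neg)
  qed
  show "h = h'"
  proof (rule extensionalityI)
    show "h \<in> extensional (carrier (free_mv K))" "h' \<in> extensional (carrier (free_mv K))"
      using h h' by auto
    show "h X = h' X" if "X \<in> carrier (free_mv K)" for X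
      using that by (elim free_mv_cases) (simp add: eq)
  qed
qed

text \<open>The type argument fixes the type of the elements of the local MV-algebra, since
  the quantifier over MV-algebras cannot range over types. The element type of \<open>free_mv K\<close>
  is large enough for all quotients of \<open>free_mv K\<close>.\<close>

definition is_local_spectrum :: "'b itself \<Rightarrow> 'p topology \<Rightarrow> bool" where
  "is_local_spectrum _ X \<longleftrightarrow>
     (\<exists>B :: 'b mv_algebra. mv_local B \<and> X homeomorphic_space mv_zariski B)"

definition one_closed_point :: "'p topology \<Rightarrow> bool" where
  "one_closed_point X \<longleftrightarrow> (\<exists>!p. p \<in> topspace X \<and> closedin X {p})"

end

theory Submission
  imports Defs
begin

text \<open>
  The argument takes place in an arbitrary MV-algebra \<open>A\<close>, with a subset \<open>I\<close> of its carrier and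
  \<open>C = V(I)\<close>. All three conditions say that exactly one maximal ideal of \<open>A\<close> contains \<open>I\<close>.

  \<^emph>\<open>Closed points.\<close> The closure of a point \<open>P\<close> of \<open>C\<close> consists of the \<open>Q \<in> C\<close> with \<open>P \<subseteq> Q\<close>. By Zorn's
  lemma every proper ideal lies in a maximal one, and maximal ideals are prime
  (\<open>maximal_imp_prime\<close>). So the closed points of \<open>C\<close> are the maximal ideals that contain \<open>I\<close>
  (\<open>closed_point_of_V_iff\<close>); in particular an MV-algebra is local iff its spectrum has exactly one
  closed point (\<open>local_iff_one_closed_point\<close>).

  \<^emph>\<open>Primary ideals.\<close> Let \<open>J\<close> be the intersection of \<open>C\<close>; it is an ideal with \<open>V(J) = C\<close>. The ideal
  generated by \<open>J\<close> and \<open>\<sim> x\<close> is \<open>{z. \<exists>n. z \<odot> x^n \<in> J}\<close>, and it is proper iff no power of \<open>x\<close> lies in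
  \<open>J\<close>. If \<open>J\<close> lies in only one maximal ideal \<open>M\<close>, and neither \<open>x\<close> nor \<open>y\<close> has a
  power in \<open>J\<close>, then \<open>\<sim> x\<close> and \<open>\<sim> y\<close> are in \<open>M\<close>, hence \<open>\<sim> (x \<odot> y) = \<sim> x \<oplus> \<sim> y \<in> M\<close> and so
  \<open>x \<odot> y \<notin> J\<close>: \<open>J\<close> is primary.
  Conversely two distinct maximal ideals \<open>M\<close>, \<open>N\<close> above \<open>J\<close> are separated by some \<open>d \<in> N\<close> with
  \<open>\<sim> d \<in> M\<close>. Then \<open>\<sim> d \<odot> d = 0\<close> lies in \<open>J\<close>, but no power of \<open>\<sim> d\<close> lies in \<open>N\<close> and no power of \<open>d\<close>
  lies in \<open>M\<close>, so \<open>J\<close> is not primary.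

  \<^emph>\<open>Local algebras.\<close> The spectrum of \<open>A/J\<close> is homeomorphic to \<open>V(J)\<close>
  (\<open>V_homeomorphic_Spec_quot\<close>). So if \<open>C\<close> has exactly one closed point, then \<open>C\<close> is the spectrum
  of the local algebra \<open>A/J\<close>. Conversely, having exactly one closed point is invariant under
  homeomorphisms, so the spectrum of a local algebra over any type of elements passes it on to
  \<open>C\<close>.
\<close>

section \<open>Order and arithmetic\<close>

context mv_algebra
begin

abbreviation unity :: 'a where "unity \<equiv> \<sim> \<zero>"
abbreviation le :: "'a \<Rightarrow> 'a \<Rightarrow> bool" (infix "\<preceq>" 50) where "x \<preceq> y \<equiv> mv_le A x y"
abbreviation times :: "'a \<Rightarrow> 'a \<Rightarrow> 'a" (infixl "\<odot>" 70) where "x \<odot> y \<equiv> mv_prod A x y"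
abbreviation meet :: "'a \<Rightarrow> 'a \<Rightarrow> 'a" (infixl "\<sqinter>" 68) where "x \<sqinter> y \<equiv> mv_meet A x y"
abbreviation join :: "'a \<Rightarrow> 'a \<Rightarrow> 'a" (infixl "\<squnion>" 66) where "x \<squnion> y \<equiv> mv_join A x y"

lemmas closed [simp] = zero_closed plus_closed neg_closed

declare neg_neg [simp] plus_zero [simp] plus_neg_zero [simp]

lemma derived_closed [simp]:
  assumes "x \<in> carrier A" "y \<in> carrier A"
  shows "x \<odot> y \<in> carrier A" "x \<sqinter> y \<in> carrier A" "x \<squnion> y \<in> carrier A"
  using assms by (simp_all add: mv_prod_def mv_meet_def mv_join_def)

lemma pow_closed [simp]: "x \<in> carrier A \<Longrightarrow> mv_pow A x n \<in> carrier A"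
  by (induction n) simp_all

lemma plus_left_comm:
  "x \<in> carrier A \<Longrightarrow> y \<in> carrier A \<Longrightarrow> z \<in> carrier A \<Longrightarrow> x \<oplus> (y \<oplus> z) = y \<oplus> (x \<oplus> z)"
  by (metis plus_assoc plus_comm)

lemmas plus_ac = plus_assoc plus_comm plus_left_comm

lemma zero_plus [simp]: "x \<in> carrier A \<Longrightarrow> \<zero> \<oplus> x = x"
  by (simp add: plus_comm[of \<zero> x])

lemma unity_plus [simp]: "x \<in> carrier A \<Longrightarrow> unity \<oplus> x = unity"
  by (simp add: plus_comm[of unity x])

lemma neg_plus_self [simp]: "x \<in> carrier A \<Longrightarrow> \<sim> x \<oplus> x = unity"
  using lukasiewicz[of x unity] by simp

lemma plus_neg_self [simp]: "x \<in> carrier A \<Longrightarrow> x \<oplus> \<sim> x = unity"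
  by (simp add: plus_comm[of x "\<sim> x"])

lemma neg_plus_left [simp]: "x \<in> carrier A \<Longrightarrow> z \<in> carrier A \<Longrightarrow> \<sim> x \<oplus> (x \<oplus> z) = unity"
  by (simp flip: plus_assoc)

lemma join_comm: "x \<in> carrier A \<Longrightarrow> y \<in> carrier A \<Longrightarrow> x \<squnion> y = y \<squnion> x"
  by (simp add: mv_join_def lukasiewicz)

lemma le_iff:
  assumes "x \<in> carrier A" "y \<in> carrier A"
  shows "x \<preceq> y \<longleftrightarrow> \<sim> x \<oplus> y = unity"
proof
  assume "x \<preceq> y"
  then have "\<sim> (\<sim> x \<oplus> y) \<oplus> y = y"
    by (simp add: mv_le_def mv_join_def)
  then have "\<sim> x \<oplus> y = \<sim> x \<oplus> (\<sim> (\<sim> x \<oplus> y) \<oplus> y)"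
    by simp
  also have "\<dots> = \<sim> (\<sim> x \<oplus> y) \<oplus> (\<sim> x \<oplus> y)"
    using assms by (simp only: plus_left_comm closed)
  finally show "\<sim> x \<oplus> y = unity"
    using assms by simp
next
  assume "\<sim> x \<oplus> y = unity"
  then show "x \<preceq> y"
    using assms by (simp add: mv_le_def mv_join_def)
qed

lemma le_plus [simp]: "x \<in> carrier A \<Longrightarrow> z \<in> carrier A \<Longrightarrow> x \<preceq> x \<oplus> z"
  by (simp add: le_iff)

lemma le_plus' [simp]: "x \<in> carrier A \<Longrightarrow> z \<in> carrier A \<Longrightarrow> x \<preceq> z \<oplus> x"
  using le_plus[of x z] by (simp add: plus_comm[of x z])

text \<open>The natural order of an MV-algebra is the divisibility order of the monoid \<open>\<oplus>\<close>; this
  turns transitivity and the monotonicity of \<open>\<oplus>\<close> into monoid computations.\<close>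

lemma leE:
  assumes "x \<preceq> y" "x \<in> carrier A" "y \<in> carrier A"
  obtains z where "z \<in> carrier A" "y = x \<oplus> z"
proof
  show "\<sim> (\<sim> y \<oplus> x) \<in> carrier A"
    using assms by simp
  have "y = y \<squnion> x"
    using assms by (simp add: mv_le_def join_comm[of y x])
  then show "y = x \<oplus> \<sim> (\<sim> y \<oplus> x)"
    using assms by (simp add: mv_join_def plus_comm[of x])
qed

lemma le_refl [simp]: "x \<in> carrier A \<Longrightarrow> x \<preceq> x"
  by (simp add: le_iff)

lemma le_trans:
  assumes "x \<preceq> y" "y \<preceq> z" "x \<in> carrier A" "y \<in> carrier A" "z \<in> carrier A"
  shows "x \<preceq> z"
  using assms by (elim leE) (auto simp: plus_assoc)

lemma le_antisym:
  assumes "x \<preceq> y" "y \<preceq> x" "x \<in> carrier A" "y \<in> carrier A"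
  shows "x = y"
  using assms join_comm[of x y] by (simp add: mv_le_def)

lemma zero_le [simp]: "x \<in> carrier A \<Longrightarrow> \<zero> \<preceq> x"
  by (simp add: le_iff)

lemma le_unity [simp]: "x \<in> carrier A \<Longrightarrow> x \<preceq> unity"
  by (simp add: le_iff)

lemma le_zero: "x \<in> carrier A \<Longrightarrow> x \<preceq> \<zero> \<longleftrightarrow> x = \<zero>"
  using le_antisym[of x \<zero>] by auto

lemma plus_mono:
  assumes "x \<preceq> x'" "y \<preceq> y'"
    and [simp]: "x \<in> carrier A" "x' \<in> carrier A" "y \<in> carrier A" "y' \<in> carrier A"
  shows "x \<oplus> y \<preceq> x' \<oplus> y'"
proof -
  obtain u v where [simp]: "u \<in> carrier A" "v \<in> carrier A" and "x' = x \<oplus> u" "y' = y \<oplus> v"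
    using assms by (elim leE)
  then have "x' \<oplus> y' = (x \<oplus> y) \<oplus> (u \<oplus> v)"
    by (simp add: plus_ac)
  then show ?thesis
    by simp
qed

lemma neg_le_iff: "x \<in> carrier A \<Longrightarrow> y \<in> carrier A \<Longrightarrow> \<sim> x \<preceq> \<sim> y \<longleftrightarrow> y \<preceq> x"
  by (simp add: le_iff plus_comm[of x "\<sim> y"])

lemma join_upper:
  assumes "x \<in> carrier A" "y \<in> carrier A"
  shows "x \<preceq> x \<squnion> y" "y \<preceq> x \<squnion> y"
proof -
  show "y \<preceq> x \<squnion> y"
    using assms by (simp add: mv_join_def)
  show "x \<preceq> x \<squnion> y"
    using assms by (simp add: join_comm[of x y]) (simp add: mv_join_def)
qed

lemma join_least:
  assumes "x \<preceq> z" "y \<preceq> z"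
    and [simp]: "x \<in> carrier A" "y \<in> carrier A" "z \<in> carrier A"
  shows "x \<squnion> y \<preceq> z"
proof -
  have "\<sim> (\<sim> x \<oplus> y) \<oplus> y \<preceq> \<sim> (\<sim> z \<oplus> y) \<oplus> y"
    using assms by (intro plus_mono) (simp_all add: neg_le_iff plus_mono)
  also have "\<sim> (\<sim> z \<oplus> y) \<oplus> y = z"
    using assms lukasiewicz[of z y] by (simp add: mv_le_def mv_join_def)
  finally show ?thesis
    by (simp add: mv_join_def)
qed

lemma meet_lower:
  assumes "x \<in> carrier A" "y \<in> carrier A"
  shows "x \<sqinter> y \<preceq> x" "x \<sqinter> y \<preceq> y"
  using assms neg_le_iff[of x "x \<sqinter> y"] neg_le_iff[of y "x \<sqinter> y"] join_upper[of "\<sim> x" "\<sim> y"]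
  by (simp_all add: mv_meet_def)

lemma meet_greatest:
  assumes "z \<preceq> x" "z \<preceq> y" "x \<in> carrier A" "y \<in> carrier A" "z \<in> carrier A"
  shows "z \<preceq> x \<sqinter> y"
  using assms join_least[of "\<sim> x" "\<sim> z" "\<sim> y"] neg_le_iff[of "x \<sqinter> y" z]
  by (simp add: mv_meet_def neg_le_iff)

lemma meet_absorb:
  assumes "x \<preceq> y" "x \<in> carrier A" "y \<in> carrier A"
  shows "x \<sqinter> y = x"
  using assms by (intro le_antisym meet_lower meet_greatest) simp_all

text \<open>Residuation. Both sides unfold to the same equation \<open>\<sim> x \<oplus> \<sim> y \<oplus> z = unity\<close>.\<close>

lemma le_neg_plus_iff:
  assumes "x \<in> carrier A" "y \<in> carrier A" "z \<in> carrier A"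
  shows "x \<preceq> \<sim> y \<oplus> z \<longleftrightarrow> x \<odot> y \<preceq> z"
  using assms by (simp add: le_iff mv_prod_def plus_assoc)

lemma le_plus_iff:
  assumes "x \<in> carrier A" "y \<in> carrier A" "z \<in> carrier A"
  shows "x \<preceq> y \<oplus> z \<longleftrightarrow> x \<odot> \<sim> y \<preceq> z"
  using assms le_neg_plus_iff[of x "\<sim> y" z] by simp

lemma le_plus_meet:
  assumes "m \<preceq> a \<oplus> x" "m \<preceq> a \<oplus> y"
    and "m \<in> carrier A" "a \<in> carrier A" "x \<in> carrier A" "y \<in> carrier A"
  shows "m \<preceq> a \<oplus> (x \<sqinter> y)"
  using assms by (simp add: le_plus_iff meet_greatest)

text \<open>Expanding the right-hand side by \<open>le_plus_meet\<close>, it suffices that \<open>x \<sqinter> (y \<oplus> z)\<close> is below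
  \<open>(x \<sqinter> y) \<oplus> x\<close>, \<open>z \<oplus> x\<close> and \<open>z \<oplus> y\<close>. The first two have \<open>x\<close> as a summand.\<close>

lemma meet_plus_le:
  assumes [simp]: "x \<in> carrier A" "y \<in> carrier A" "z \<in> carrier A"
  shows "x \<sqinter> (y \<oplus> z) \<preceq> (x \<sqinter> y) \<oplus> (x \<sqinter> z)"
proof -
  let ?m = "x \<sqinter> (y \<oplus> z)"
  have x: "?m \<preceq> u \<oplus> x" "?m \<preceq> x \<oplus> u" if [simp]: "u \<in> carrier A" for u
    by (rule le_trans[OF meet_lower(1)]; simp)+
  have "?m \<preceq> z \<oplus> y"
    using meet_lower(2)[of x "y \<oplus> z"] by (simp add: plus_comm[of z y])
  then have "?m \<preceq> (x \<sqinter> y) \<oplus> z"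
    using le_plus_meet[of ?m z x y] x by (simp add: plus_comm[of "x \<sqinter> y" z])
  then show ?thesis
    by (intro le_plus_meet x) simp_all
qed

lemma prod_comm: "x \<in> carrier A \<Longrightarrow> y \<in> carrier A \<Longrightarrow> x \<odot> y = y \<odot> x"
  by (simp add: mv_prod_def plus_comm)

lemma prod_assoc:
  "x \<in> carrier A \<Longrightarrow> y \<in> carrier A \<Longrightarrow> z \<in> carrier A \<Longrightarrow> (x \<odot> y) \<odot> z = x \<odot> (y \<odot> z)"
  by (simp add: mv_prod_def plus_assoc)

lemma prod_unity [simp]:
  assumes "x \<in> carrier A"
  shows "x \<odot> unity = x" "unity \<odot> x = x"
  using assms by (simp_all add: mv_prod_def)

lemma prod_neg_self [simp]: "x \<in> carrier A \<Longrightarrow> \<sim> x \<odot> x = \<zero>"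
  by (simp add: mv_prod_def)

lemma prod_mono_left:
  assumes "x \<preceq> y" "x \<in> carrier A" "y \<in> carrier A" "z \<in> carrier A"
  shows "x \<odot> z \<preceq> y \<odot> z"
  using assms by (simp add: mv_prod_def neg_le_iff plus_mono)

lemma pow_add: "x \<in> carrier A \<Longrightarrow> mv_pow A x (m + n) = mv_pow A x m \<odot> mv_pow A x n"
  by (induction n) (simp_all add: prod_assoc)

lemma neg_pow_Suc: "x \<in> carrier A \<Longrightarrow> \<sim> mv_pow A x (Suc n) = \<sim> mv_pow A x n \<oplus> \<sim> x"
  by (simp add: mv_prod_def)

lemma le_plus_prod: "x \<in> carrier A \<Longrightarrow> y \<in> carrier A \<Longrightarrow> x \<preceq> \<sim> y \<oplus> x \<odot> y"
  by (simp add: le_neg_plus_iff)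

text \<open>What makes \<open>saturation\<close> below closed under \<open>\<oplus>\<close>. By residuation the claim is
  \<open>z \<oplus> w \<preceq> \<sim> p \<oplus> \<sim> q \<oplus> z \<odot> p \<oplus> w \<odot> q\<close>, which is the sum of two instances of
  \<open>le_plus_prod\<close>.\<close>

lemma plus_prod_le:
  assumes [simp]: "z \<in> carrier A" "w \<in> carrier A" "p \<in> carrier A" "q \<in> carrier A"
  shows "(z \<oplus> w) \<odot> (p \<odot> q) \<preceq> z \<odot> p \<oplus> w \<odot> q"
proof -
  have "z \<oplus> w \<preceq> (\<sim> p \<oplus> z \<odot> p) \<oplus> (\<sim> q \<oplus> w \<odot> q)"
    by (intro plus_mono le_plus_prod) simp_all
  also have "\<dots> = \<sim> (p \<odot> q) \<oplus> (z \<odot> p \<oplus> w \<odot> q)"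
    by (simp add: mv_prod_def plus_ac)
  finally show ?thesis
    by (simp add: le_neg_plus_iff)
qed

section \<open>Ideals\<close>

lemma idealD:
  assumes "mv_ideal A J"
  shows ideal_closed: "x \<in> J \<Longrightarrow> x \<in> carrier A"
    and ideal_zero: "\<zero> \<in> J"
    and ideal_down: "x \<preceq> y \<Longrightarrow> y \<in> J \<Longrightarrow> x \<in> carrier A \<Longrightarrow> x \<in> J"
    and ideal_plus: "x \<in> J \<Longrightarrow> y \<in> J \<Longrightarrow> x \<oplus> y \<in> J"
proof -
  have sub: "J \<subseteq> carrier A" and "J \<noteq> {}"
    and down: "\<And>x y. x \<in> carrier A \<Longrightarrow> y \<in> J \<Longrightarrow> x \<preceq> y \<Longrightarrow> x \<in> J"
    and plus: "\<And>x y. x \<in> J \<Longrightarrow> y \<in> J \<Longrightarrow> x \<oplus> y \<in> J"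
    using assms unfolding mv_ideal_def by blast+
  then have "\<exists>y\<in>J. \<zero> \<preceq> y"
    by (metis all_not_in_conv subsetD zero_le)
  then show "\<zero> \<in> J"
    using down by auto
  show "x \<in> J \<Longrightarrow> x \<in> carrier A" "x \<preceq> y \<Longrightarrow> y \<in> J \<Longrightarrow> x \<in> carrier A \<Longrightarrow> x \<in> J"
    "x \<in> J \<Longrightarrow> y \<in> J \<Longrightarrow> x \<oplus> y \<in> J"
    using sub down plus by blast+
qed

lemma ideal_proper_iff:
  assumes "mv_ideal A J"
  shows "J \<noteq> carrier A \<longleftrightarrow> unity \<notin> J"
proof
  show "unity \<notin> J" if "J \<noteq> carrier A"
  proof
    assume "unity \<in> J"
    then have "x \<in> J" if "x \<in> carrier A" for x
      using assms that ideal_down[of J x unity] by simp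
    then show False
      using assms \<open>J \<noteq> carrier A\<close> ideal_closed by blast
  qed
qed auto

lemma mv_ideal_Inter:
  assumes "\<And>P. P \<in> C \<Longrightarrow> mv_ideal A P"
  shows "mv_ideal A (mv_Inter A C)"
  unfolding mv_ideal_def
proof (intro conjI ballI impI)
  have "\<zero> \<in> mv_Inter A C"
    using ideal_zero[OF assms] by (simp add: mv_Inter_def)
  then show "mv_Inter A C \<noteq> {}"
    by blast
  show "x \<in> mv_Inter A C" if "x \<in> carrier A" "y \<in> mv_Inter A C" "x \<preceq> y" for x y
    using that ideal_down[OF assms, of _ x y] by (simp add: mv_Inter_def)
  show "x \<oplus> y \<in> mv_Inter A C" if "x \<in> mv_Inter A C" "y \<in> mv_Inter A C" for x y
    using that ideal_plus[OF assms, of _ x y] by (simp add: mv_Inter_def)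
qed (simp add: mv_Inter_def)

lemma ex_maximal_ideal:
  assumes J: "mv_ideal A J" "J \<noteq> carrier A"
  obtains M where "mv_maximal A M" "J \<subseteq> M"
proof -
  define \<F> where "\<F> = {N. mv_ideal A N \<and> unity \<notin> N \<and> J \<subseteq> N}"
  have "\<exists>U\<in>\<F>. \<forall>N\<in>\<C>. N \<subseteq> U" if chain: "subset.chain \<F> \<C>" for \<C>
  proof (cases "\<C> = {}")
    case True
    then show ?thesis
      using J by (auto simp: \<F>_def ideal_proper_iff)
  next
    case False
    have \<C>: "mv_ideal A N" "unity \<notin> N" "J \<subseteq> N" if "N \<in> \<C>" for N
      using chain that by (auto simp: \<F>_def subset.chain_def)
    have "mv_ideal A (\<Union>\<C>)"
      unfolding mv_ideal_def
    proof (intro conjI ballI impI)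
      show "\<Union>\<C> \<subseteq> carrier A"
        using \<C> ideal_closed by blast
      show "\<Union>\<C> \<noteq> {}"
        using \<C> ideal_zero False by blast
      show "x \<in> \<Union>\<C>" if "x \<in> carrier A" "y \<in> \<Union>\<C>" "x \<preceq> y" for x y
        using that \<C> ideal_down by blast
      fix x y
      assume "x \<in> \<Union>\<C>" "y \<in> \<Union>\<C>"
      then obtain M N where "M \<in> \<C>" "N \<in> \<C>" "x \<in> M" "y \<in> N"
        by blast
      moreover have "M \<subseteq> N \<or> N \<subseteq> M"
        using chain \<open>M \<in> \<C>\<close> \<open>N \<in> \<C>\<close> by (auto simp: subset.chain_def)
      ultimately show "x \<oplus> y \<in> \<Union>\<C>"
        using \<C>(1) ideal_plus by blast
    qed
    moreover have "unity \<notin> \<Union>\<C>" "J \<subseteq> \<Union>\<C>"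
      using \<C>(2,3) False by blast+
    ultimately have "\<Union>\<C> \<in> \<F>"
      by (simp add: \<F>_def)
    then show ?thesis
      by blast
  qed
  then obtain M where M: "M \<in> \<F>" and max: "\<And>N. N \<in> \<F> \<Longrightarrow> M \<subseteq> N \<Longrightarrow> N = M"
    using subset_Zorn[of \<F>] by metis
  have "mv_maximal A M"
    unfolding mv_maximal_def
  proof (intro conjI allI impI)
    show "mv_ideal A M" "M \<noteq> carrier A"
      using M by (auto simp: \<F>_def)
    show "N = M" if "mv_ideal A N \<and> M \<subseteq> N \<and> N \<noteq> carrier A" for N
      using that M ideal_proper_iff[of N] by (intro max) (auto simp: \<F>_def)
  qed
  then show thesis
    using that M by (auto simp: \<F>_def)
qed

lemma maximalD:
  assumes "mv_maximal A M"
  shows maximal_ideal: "mv_ideal A M"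
    and maximal_proper: "unity \<notin> M"
    and maximal_eq: "mv_ideal A N \<Longrightarrow> M \<subseteq> N \<Longrightarrow> unity \<notin> N \<Longrightarrow> N = M"
  using assms ideal_proper_iff by (auto simp: mv_maximal_def)

text \<open>The analogue of a colon ideal. It is closed under \<open>\<oplus>\<close> because of \<open>meet_plus_le\<close>.\<close>

lemma ideal_residual:
  assumes J: "mv_ideal A J" and [simp]: "x \<in> carrier A"
  shows "mv_ideal A {z \<in> carrier A. x \<sqinter> z \<in> J}"
  unfolding mv_ideal_def
proof (intro conjI ballI impI)
  have "x \<sqinter> \<zero> = \<zero>"
    using meet_lower(2)[of x \<zero>] by (simp add: le_zero)
  then show "{z \<in> carrier A. x \<sqinter> z \<in> J} \<noteq> {}"
    using ideal_zero[OF J] by (intro ex_in_conv[THEN iffD1] exI[of _ \<zero>]) simp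
next
  fix u v
  assume "u \<in> carrier A" "v \<in> {z \<in> carrier A. x \<sqinter> z \<in> J}" "u \<preceq> v"
  moreover from this have "x \<sqinter> u \<preceq> x \<sqinter> v"
    using meet_lower[of x u] by (intro meet_greatest) (auto intro: le_trans[of _ u])
  ultimately show "u \<in> {z \<in> carrier A. x \<sqinter> z \<in> J}"
    using ideal_down[OF J] by simp
next
  fix u v
  assume "u \<in> {z \<in> carrier A. x \<sqinter> z \<in> J}" "v \<in> {z \<in> carrier A. x \<sqinter> z \<in> J}"
  then show "u \<oplus> v \<in> {z \<in> carrier A. x \<sqinter> z \<in> J}"
    using ideal_plus[OF J, of "x \<sqinter> u" "x \<sqinter> v"] ideal_down[OF J meet_plus_le[of x u v]] by simp
qed auto

text \<open>For \<open>x \<notin> M\<close> the ideal of all \<open>z\<close> with \<open>x \<sqinter> z \<in> M\<close> contains \<open>M\<close>, but not the unit, since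
  \<open>x \<sqinter> unity = x\<close>. By maximality it is \<open>M\<close> itself, which is primeness.\<close>

lemma maximal_imp_prime:
  assumes M: "mv_maximal A M"
  shows "mv_prime A M"
  unfolding mv_prime_def
proof (intro conjI ballI impI)
  show "mv_ideal A M" "M \<noteq> carrier A"
    using M by (simp_all add: mv_maximal_def)
  fix x y
  assume [simp]: "x \<in> carrier A" "y \<in> carrier A" and xy: "x \<sqinter> y \<in> M"
  show "x \<in> M \<or> y \<in> M"
  proof (cases "x \<in> M")
    case False
    let ?N = "{z \<in> carrier A. x \<sqinter> z \<in> M}"
    have "x \<sqinter> unity = x"
      by (simp add: meet_absorb)
    then have "unity \<notin> ?N"
      using False by simp
    moreover have "M \<subseteq> ?N"
    proof
      fix z
      assume "z \<in> M"
      then show "z \<in> ?N"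
        using maximal_ideal[OF M] ideal_closed[of M z] ideal_down[of M "x \<sqinter> z" z] meet_lower(2)
        by simp
    qed
    ultimately have "?N = M"
      by (intro maximal_eq[OF M] ideal_residual maximal_ideal[OF M]) simp_all
    moreover have "y \<in> ?N"
      using xy by simp
    ultimately show ?thesis
      by metis
  qed simp
qed

text \<open>The ideal generated by \<open>J\<close> and \<open>\<sim> x\<close>: by residuation \<open>z \<odot> x^n \<in> J\<close> holds iff
  \<open>z \<preceq> \<sim> (x^n) \<oplus> j\<close> for some \<open>j \<in> J\<close>, where \<open>\<sim> (x^n)\<close> is the \<open>n\<close>-fold sum of \<open>\<sim> x\<close>. In this form its
  properness is visibly a condition on the powers of \<open>x\<close>.\<close>

definition saturation :: "'a set \<Rightarrow> 'a \<Rightarrow> 'a set" where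
  "saturation J x = {z \<in> carrier A. \<exists>n. z \<odot> mv_pow A x n \<in> J}"

lemma saturation:
  assumes J: "mv_ideal A J" and [simp]: "x \<in> carrier A"
  shows mv_ideal_saturation: "mv_ideal A (saturation J x)"
    and subset_saturation: "J \<subseteq> saturation J x"
    and neg_in_saturation: "\<sim> x \<in> saturation J x"
    and unity_in_saturation_iff: "unity \<in> saturation J x \<longleftrightarrow> (\<exists>n. mv_pow A x n \<in> J)"
proof -
  let ?N = "saturation J x"
  have "z \<odot> mv_pow A x 0 \<in> J" if "z \<in> J" for z
    using ideal_closed[OF J that] that by simp
  then show JN: "J \<subseteq> ?N"
    unfolding saturation_def using ideal_closed[OF J] by blast
  have "\<sim> x \<odot> mv_pow A x (Suc 0) \<in> J"
    using ideal_zero[OF J] by simp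
  then show "\<sim> x \<in> ?N"
    unfolding saturation_def by (intro CollectI conjI exI[of _ "Suc 0"]) simp_all
  show "unity \<in> ?N \<longleftrightarrow> (\<exists>n. mv_pow A x n \<in> J)"
    by (simp add: saturation_def)
  show "mv_ideal A ?N"
    unfolding mv_ideal_def
  proof (intro conjI ballI impI)
    show "?N \<subseteq> carrier A" "?N \<noteq> {}"
      using JN ideal_zero[OF J] by (auto simp: saturation_def)
    fix u v
    show "u \<in> ?N" if uv: "u \<in> carrier A" "v \<in> ?N" "u \<preceq> v"
      proof -
      obtain n where n: "v \<in> carrier A" "v \<odot> mv_pow A x n \<in> J"
        using uv by (auto simp: saturation_def)
      then have "u \<odot> mv_pow A x n \<in> J"
        using uv prod_mono_left[of u v "mv_pow A x n"] ideal_down[OF J] by simp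
      then show ?thesis
        using uv by (auto simp: saturation_def)
    qed
    assume "u \<in> ?N" "v \<in> ?N"
    then obtain m n where [simp]: "u \<in> carrier A" "v \<in> carrier A"
      and "u \<odot> mv_pow A x m \<in> J" "v \<odot> mv_pow A x n \<in> J"
      by (auto simp: saturation_def)
    then have "u \<odot> mv_pow A x m \<oplus> v \<odot> mv_pow A x n \<in> J"
      using ideal_plus[OF J] by simp
    then have "(u \<oplus> v) \<odot> mv_pow A x (m + n) \<in> J"
      unfolding pow_add[OF assms(2)] by (rule ideal_down[OF J plus_prod_le, rotated -2]) simp_all
    then show "u \<oplus> v \<in> ?N"
      by (auto simp: saturation_def)
  qed
qed

lemma ideal_neg_pow:
  assumes J: "mv_ideal A J" and "x \<in> carrier A" "\<sim> x \<in> J"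
  shows "\<sim> mv_pow A x n \<in> J"
proof (induction n)
  case 0
  then show ?case
    using ideal_zero[OF J] by simp
next
  case (Suc n)
  then show ?case
    using assms ideal_plus[OF J] by (simp add: neg_pow_Suc del: mv_pow.simps)
qed

text \<open>If \<open>\<sim> x\<close> lies in \<open>J\<close>, then so does the complement of every power of \<open>x\<close>, and a proper
  ideal does not contain an element together with its complement.\<close>

lemma pow_notin_ideal:
  assumes J: "mv_ideal A J" "unity \<notin> J" and "x \<in> carrier A" "\<sim> x \<in> J"
  shows "mv_pow A x n \<notin> J"
  using ideal_plus[OF J(1), of "mv_pow A x n" "\<sim> mv_pow A x n"] ideal_neg_pow[of J x n] assms
  by auto

text \<open>An element \<open>a\<close> of \<open>M - N\<close> yields complementary elements, one in each ideal: by
  maximality of \<open>N\<close> some power \<open>d\<close> of \<open>\<sim> a\<close> lies in \<open>N\<close>, and its complement is a multiple of \<open>a\<close>,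
  hence in \<open>M\<close>. The product of \<open>\<sim> d\<close> and \<open>d\<close> is zero, so it witnesses that \<open>J\<close> is not primary.\<close>

lemma primary_imp_maximal_unique:
  assumes J: "mv_primary A J" and M: "mv_maximal A M" "J \<subseteq> M" and N: "mv_maximal A N" "J \<subseteq> N"
  shows "M = N"
proof (rule ccontr)
  assume "M \<noteq> N"
  then obtain a where a: "a \<in> M" "a \<notin> N"
    using maximal_eq[OF M(1) maximal_ideal[OF N(1)]] maximal_proper[OF N(1)] by blast
  have [simp]: "a \<in> carrier A"
    using a ideal_closed maximal_ideal[OF M(1)] by blast
  note L = saturation[OF maximal_ideal[OF N(1)], of "\<sim> a"]
  have "saturation N (\<sim> a) \<noteq> N"
    using L(3) a by auto
  then have "unity \<in> saturation N (\<sim> a)"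
    using maximal_eq[OF N(1) L(1,2)] by auto
  then obtain n where n: "mv_pow A (\<sim> a) n \<in> N"
    using L(4) by auto
  define d where "d = mv_pow A (\<sim> a) n"
  have [simp]: "d \<in> carrier A"
    by (simp add: d_def)
  have d: "d \<in> N" "\<sim> d \<in> M"
    using n a ideal_neg_pow[OF maximal_ideal[OF M(1)], of "\<sim> a"] by (simp_all add: d_def)
  have "\<sim> d \<odot> d \<in> J"
    using J ideal_zero by (simp add: mv_primary_def)
  then obtain k where "mv_pow A (\<sim> d) k \<in> J \<or> mv_pow A d k \<in> J"
    using J unfolding mv_primary_def by (meson \<open>d \<in> carrier A\<close> neg_closed)
  moreover have "mv_pow A (\<sim> d) k \<notin> N"
    using d by (intro pow_notin_ideal maximal_ideal maximal_proper N) simp_all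
  moreover have "mv_pow A d k \<notin> M"
    using d by (intro pow_notin_ideal maximal_ideal maximal_proper M) simp_all
  ultimately show False
    using M N by blast
qed

text \<open>If no power of \<open>x\<close> lies in \<open>J\<close>, then \<open>saturation J x\<close> is proper, so it lies in the only
  maximal ideal \<open>M\<close> above \<open>J\<close>, and \<open>\<sim> x \<in> M\<close>. This cannot happen for both factors of a
  product in \<open>J\<close>, since \<open>M\<close> would contain \<open>x \<odot> y\<close> and its complement \<open>\<sim> x \<oplus> \<sim> y\<close>.\<close>

lemma unique_maximal_imp_primary:
  assumes J: "mv_ideal A J" "J \<noteq> carrier A" and M: "mv_maximal A M"
    and unique: "\<And>N. mv_maximal A N \<Longrightarrow> J \<subseteq> N \<Longrightarrow> N = M"
  shows "mv_primary A J"
  unfolding mv_primary_def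
proof (intro conjI ballI impI)
  show "mv_ideal A J" "J \<noteq> carrier A"
    by (fact J)+
  have JM: "J \<subseteq> M"
    using ex_maximal_ideal[OF J] unique by metis
  have powers: "\<exists>n\<ge>1. mv_pow A x n \<in> J" if [simp]: "x \<in> carrier A" and x: "\<sim> x \<notin> M" for x
  proof -
    note N = saturation[OF J(1), of x]
    have "saturation J x = carrier A"
    proof (rule ccontr)
      assume "saturation J x \<noteq> carrier A"
      then obtain L where "mv_maximal A L" "saturation J x \<subseteq> L"
        using ex_maximal_ideal[OF N(1)] by auto
      then show False
        using N(2,3) unique[of L] x by auto
    qed
    then obtain n where n: "mv_pow A x n \<in> J"
      using N(4) by auto
    moreover have "n \<noteq> 0"
      using n J ideal_proper_iff by (cases n) auto
    ultimately show ?thesis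
      by (intro exI[of _ n]) simp
  qed
  fix x y
  assume [simp]: "x \<in> carrier A" "y \<in> carrier A" and xy: "x \<odot> y \<in> J"
  have "\<not> (\<sim> x \<in> M \<and> \<sim> y \<in> M)"
  proof
    assume "\<sim> x \<in> M \<and> \<sim> y \<in> M"
    then have "x \<odot> y \<oplus> (\<sim> x \<oplus> \<sim> y) \<in> M"
      using xy JM ideal_plus[OF maximal_ideal[OF M]] by auto
    then show False
      using maximal_proper[OF M] by (simp add: mv_prod_def)
  qed
  then show "\<exists>n\<ge>1. mv_pow A x n \<in> J \<or> mv_pow A y n \<in> J"
    using powers[of x] powers[of y] by auto
qed

section \<open>Closed points of the spectrum\<close>

lemma prime_ideal: "P \<in> mv_Spec A \<Longrightarrow> mv_ideal A P"
  by (simp add: mv_Spec_def mv_prime_def)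

lemma openin_zariski_basic: "a \<in> carrier A \<Longrightarrow> openin (mv_zariski A) {P \<in> mv_Spec A. a \<notin> P}"
  unfolding mv_zariski_def by (rule topology_generated_by_Basis) auto

text \<open>Basic open sets are closed under passing to smaller prime ideals, and unions and
  intersections preserve this.\<close>

lemma openin_zariski_generalization:
  assumes "openin (mv_zariski A) U" "Q \<in> U" "P \<in> mv_Spec A" "P \<subseteq> Q"
  shows "P \<in> U"
proof -
  have "generate_topology_on {{P \<in> mv_Spec A. a \<notin> P} |a. a \<in> carrier A} U"
    using assms(1) by (simp add: mv_zariski_def openin_topology_generated_by_iff)
  then show ?thesis
    using assms(2) by induction (use assms(3,4) in auto)
qed

text \<open>The closure of \<open>P\<close> in \<open>C\<close> is the set of all \<open>Q \<in> C\<close> that contain \<open>P\<close>: these \<open>Q\<close> have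
  no open neighbourhood that misses \<open>P\<close>, and the others form the union of the basic open sets
  given by the elements of \<open>P\<close>.\<close>

lemma closedin_point_iff:
  assumes C: "C \<subseteq> mv_Spec A" and P: "P \<in> C"
  shows "closedin (subtopology (mv_zariski A) C) {P} \<longleftrightarrow> (\<forall>Q\<in>C. P \<subseteq> Q \<longrightarrow> Q = P)"
proof
  assume "closedin (subtopology (mv_zariski A) C) {P}"
  then have "openin (subtopology (mv_zariski A) C) (C - {P})"
    using C by (simp add: closedin_def topspace_mv_zariski Int_absorb1)
  then obtain U where U: "openin (mv_zariski A) U" "C - {P} = U \<inter> C"
    by (auto simp: openin_subtopology)
  show "\<forall>Q\<in>C. P \<subseteq> Q \<longrightarrow> Q = P"
    using openin_zariski_generalization[OF U(1)] U(2) C P by blast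
next
  assume max: "\<forall>Q\<in>C. P \<subseteq> Q \<longrightarrow> Q = P"
  let ?U = "\<Union>a\<in>P. {Q \<in> mv_Spec A. a \<notin> Q}"
  have "openin (mv_zariski A) ?U"
    using P C prime_ideal ideal_closed by (intro openin_Union) (auto intro!: openin_zariski_basic)
  moreover have "C - {P} = ?U \<inter> C"
    using max C by auto
  ultimately show "closedin (subtopology (mv_zariski A) C) {P}"
    using C P by (auto simp: closedin_def topspace_mv_zariski Int_absorb1 openin_subtopology)
qed

text \<open>A closed point is maximal among the primes above \<open>I\<close>. As it lies in a maximal ideal,
  which is itself a prime above \<open>I\<close>, it is a maximal ideal.\<close>

lemma closed_point_of_V_iff:
  assumes "I \<subseteq> carrier A"
  shows "P \<in> mv_V A I \<and> closedin (subtopology (mv_zariski A) (mv_V A I)) {P} \<longleftrightarrow>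
    mv_maximal A P \<and> I \<subseteq> P" (is "?L \<longleftrightarrow> ?R")
proof
  have V: "mv_V A I \<subseteq> mv_Spec A"
    by (auto simp: mv_V_def)
  show ?R if ?L
  proof -
    have P: "P \<in> mv_Spec A" "I \<subseteq> P"
      using that by (auto simp: mv_V_def)
    then obtain M where M: "mv_maximal A M" "P \<subseteq> M"
      using ex_maximal_ideal[of P] by (auto simp: mv_Spec_def mv_prime_def)
    then have "M \<in> mv_V A I"
      using P maximal_imp_prime by (auto simp: mv_V_def mv_Spec_def)
    then have "M = P"
      using that M closedin_point_iff[OF V] by blast
    then show ?R
      using M P by simp
  qed
  show ?L if ?R
  proof -
    have "P \<in> mv_V A I"
      using that maximal_imp_prime by (auto simp: mv_V_def mv_Spec_def)
    moreover have "Q = P" if "Q \<in> mv_V A I" "P \<subseteq> Q" for Q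
      using that \<open>?R\<close> V by (auto simp: mv_maximal_def mv_V_def mv_Spec_def mv_prime_def)
    ultimately show ?L
      using closedin_point_iff[OF V] by blast
  qed
qed

lemma one_closed_point_V_iff:
  assumes "I \<subseteq> carrier A"
  shows "one_closed_point (subtopology (mv_zariski A) (mv_V A I)) \<longleftrightarrow>
    (\<exists>!M. mv_maximal A M \<and> I \<subseteq> M)"
proof -
  have "topspace (subtopology (mv_zariski A) (mv_V A I)) = mv_V A I"
    by (auto simp: topspace_mv_zariski mv_V_def)
  then show ?thesis
    unfolding one_closed_point_def using closed_point_of_V_iff[OF assms] by simp
qed

lemma local_iff_one_closed_point: "mv_local A \<longleftrightarrow> one_closed_point (mv_zariski A)"
proof -
  have "subtopology (mv_zariski A) (mv_V A {}) = mv_zariski A"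
    using subtopology_topspace[of "mv_zariski A"] by (simp add: topspace_mv_zariski mv_V_def)
  then show ?thesis
    using one_closed_point_V_iff[of "{}"] mv_algebra_axioms by (simp add: mv_local_def)
qed

lemma ideal_Inter_V: "mv_ideal A (mv_Inter A (mv_V A I))"
  by (rule mv_ideal_Inter) (auto simp: mv_V_def prime_ideal)

lemma V_Inter_V:
  assumes "I \<subseteq> carrier A"
  shows "mv_V A (mv_Inter A (mv_V A I)) = mv_V A I"
  using assms by (auto simp: mv_V_def mv_Inter_def)

text \<open>Here \<open>I\<close> may be replaced by the intersection \<open>J\<close> of \<open>V(I)\<close>, which cuts out the same
  closed set; then both sides say that \<open>J\<close> lies in exactly one maximal ideal. If \<open>V(I)\<close> is
  empty, both sides fail: \<open>J\<close> is then the whole carrier, and primary ideals are proper.\<close>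

theorem one_closed_point_iff_primary:
  assumes I: "I \<subseteq> carrier A"
  shows "one_closed_point (subtopology (mv_zariski A) (mv_V A I)) \<longleftrightarrow>
    mv_primary A (mv_Inter A (mv_V A I))"
proof -
  let ?J = "mv_Inter A (mv_V A I)"
  have "?J \<subseteq> carrier A"
    by (auto simp: mv_Inter_def)
  then have "one_closed_point (subtopology (mv_zariski A) (mv_V A I)) \<longleftrightarrow>
      (\<exists>!M. mv_maximal A M \<and> ?J \<subseteq> M)"
    using one_closed_point_V_iff[of ?J] V_Inter_V[OF I] by simp
  also have "\<dots> \<longleftrightarrow> mv_primary A ?J"
  proof
    assume "\<exists>!M. mv_maximal A M \<and> ?J \<subseteq> M"
    then obtain M where M: "mv_maximal A M" "?J \<subseteq> M"
      and unique: "\<And>N. mv_maximal A N \<Longrightarrow> ?J \<subseteq> N \<Longrightarrow> N = M"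
      by blast
    have "?J \<noteq> carrier A"
      using M maximal_proper ideal_proper_iff[OF ideal_Inter_V] by blast
    then show "mv_primary A ?J"
      by (rule unique_maximal_imp_primary[OF ideal_Inter_V _ M(1) unique])
  next
    assume J: "mv_primary A ?J"
    then obtain M where "mv_maximal A M" "?J \<subseteq> M"
      using ex_maximal_ideal[of ?J] by (auto simp: mv_primary_def)
    then show "\<exists>!M. mv_maximal A M \<and> ?J \<subseteq> M"
      using primary_imp_maximal_unique[OF J] by blast
  qed
  finally show ?thesis .
qed

end

section \<open>Quotients and their spectra\<close>

locale mv_surjection = A: mv_algebra A + B: mv_algebra B
  for A :: "'a mv_algebra" and B :: "'b mv_algebra" +
  fixes h :: "'a \<Rightarrow> 'b"
  assumes hom: "h \<in> mv_hom A B" and surj: "h ` carrier A = carrier B"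
begin

definition kernel :: "'a set" where
  "kernel = {x \<in> carrier A. h x = \<zero>\<^bsub>B\<^esub>}"

lemma h_closed [simp]: "x \<in> carrier A \<Longrightarrow> h x \<in> carrier B"
  using surj by auto

lemma h_simps [simp]:
  "x \<in> carrier A \<Longrightarrow> y \<in> carrier A \<Longrightarrow> h (x \<oplus>\<^bsub>A\<^esub> y) = h x \<oplus>\<^bsub>B\<^esub> h y"
  "h \<zero>\<^bsub>A\<^esub> = \<zero>\<^bsub>B\<^esub>"
  "x \<in> carrier A \<Longrightarrow> h (\<sim>\<^bsub>A\<^esub> x) = \<sim>\<^bsub>B\<^esub> h x"
  using hom by (auto simp: mv_hom_def)

lemma h_derived [simp]:
  assumes "x \<in> carrier A" "y \<in> carrier A"
  shows "h (mv_join A x y) = mv_join B (h x) (h y)"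
    and "h (mv_meet A x y) = mv_meet B (h x) (h y)"
    and "h (mv_prod A x y) = mv_prod B (h x) (h y)"
  using assms by (simp_all add: mv_join_def mv_meet_def mv_prod_def)

lemma h_mono: "mv_le A x y \<Longrightarrow> x \<in> carrier A \<Longrightarrow> y \<in> carrier A \<Longrightarrow> mv_le B (h x) (h y)"
  unfolding mv_le_def by (metis h_derived(1))

definition pull :: "'b set \<Rightarrow> 'a set" where
  "pull Q = {x \<in> carrier A. h x \<in> Q}"

lemma image_pull: "Q \<subseteq> carrier B \<Longrightarrow> h ` pull Q = Q"
  using surj by (auto simp: pull_def)

text \<open>If \<open>h x = h p\<close> with \<open>p \<in> P\<close>, then \<open>x \<odot> \<sim> p\<close> is in the kernel, hence in \<open>P\<close>, and
  \<open>x \<preceq> p \<oplus> x \<odot> \<sim> p\<close>.\<close>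

lemma pull_image:
  assumes P: "mv_ideal A P" "kernel \<subseteq> P"
  shows "pull (h ` P) = P"
proof
  show "P \<subseteq> pull (h ` P)"
    using A.ideal_closed[OF P(1)] by (auto simp: pull_def)
  show "pull (h ` P) \<subseteq> P"
  proof
    fix x
    assume "x \<in> pull (h ` P)"
    then obtain p where p: "p \<in> P" "h x = h p" and [simp]: "x \<in> carrier A"
      by (auto simp: pull_def)
    have [simp]: "p \<in> carrier A"
      using p A.ideal_closed[OF P(1)] by simp
    let ?d = "mv_prod A x (\<sim>\<^bsub>A\<^esub> p)"
    have "h ?d = \<zero>\<^bsub>B\<^esub>"
      using p B.prod_neg_self[of "h p"] by (simp add: B.prod_comm)
    then have "?d \<in> P"
      using P by (auto simp: kernel_def)
    then have "p \<oplus>\<^bsub>A\<^esub> ?d \<in> P"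
      using p A.ideal_plus[OF P(1)] by simp
    moreover have "mv_le A x (p \<oplus>\<^bsub>A\<^esub> ?d)"
      by (simp add: A.le_plus_iff)
    ultimately show "x \<in> P"
      using A.ideal_down[OF P(1)] by simp
  qed
qed

lemma pull_in_V:
  assumes "Q \<in> mv_Spec B"
  shows "pull Q \<in> mv_V A kernel"
proof -
  have Q: "mv_ideal B Q" "Q \<noteq> carrier B"
    "\<And>x y. x \<in> carrier B \<Longrightarrow> y \<in> carrier B \<Longrightarrow> mv_meet B x y \<in> Q \<Longrightarrow> x \<in> Q \<or> y \<in> Q"
    using assms by (auto simp: mv_Spec_def mv_prime_def)
  have "mv_ideal A (pull Q)"
    unfolding mv_ideal_def
  proof (intro conjI ballI impI)
    have "\<zero>\<^bsub>A\<^esub> \<in> pull Q"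
      using B.ideal_zero[OF Q(1)] by (simp add: pull_def)
    then show "pull Q \<noteq> {}"
      by blast
    show "x \<in> pull Q" if "x \<in> carrier A" "y \<in> pull Q" "mv_le A x y" for x y
      using that B.ideal_down[OF Q(1) h_mono] by (simp add: pull_def)
  qed (auto simp: pull_def B.ideal_plus[OF Q(1)])
  moreover have "pull Q \<noteq> carrier A"
  proof -
    have "h ` pull Q = Q"
      using B.ideal_closed[OF Q(1)] by (intro image_pull) auto
    then show ?thesis
      using surj Q(2) by auto
  qed
  moreover have "x \<in> pull Q \<or> y \<in> pull Q"
    if "x \<in> carrier A" "y \<in> carrier A" "mv_meet A x y \<in> pull Q" for x y
    using that Q(3)[of "h x" "h y"] by (simp add: pull_def)
  moreover have "kernel \<subseteq> pull Q"
    using B.ideal_zero[OF Q(1)] by (auto simp: kernel_def pull_def)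
  ultimately show ?thesis
    by (simp add: mv_V_def mv_Spec_def mv_prime_def)
qed

text \<open>An element below \<open>h y\<close> with \<open>y \<in> P\<close> has the form \<open>h x = h x \<sqinter> h y = h (x \<sqinter> y)\<close>, and
  \<open>x \<sqinter> y\<close> is in \<open>P\<close>; so the image is downward closed. Primeness and properness are inherited
  because \<open>h x \<in> h ` P\<close> already implies \<open>x \<in> P\<close>.\<close>

lemma image_in_Spec:
  assumes "P \<in> mv_V A kernel"
  shows "h ` P \<in> mv_Spec B"
proof -
  have P: "mv_ideal A P" "P \<noteq> carrier A" "kernel \<subseteq> P"
    "\<And>x y. x \<in> carrier A \<Longrightarrow> y \<in> carrier A \<Longrightarrow> mv_meet A x y \<in> P \<Longrightarrow> x \<in> P \<or> y \<in> P"
    using assms by (auto simp: mv_V_def mv_Spec_def mv_prime_def)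
  have h_mem: "h x \<in> h ` P \<longleftrightarrow> x \<in> P" if "x \<in> carrier A" for x
    using pull_image[OF P(1,3)] that by (auto simp: pull_def)
  have "mv_ideal B (h ` P)"
    unfolding mv_ideal_def
  proof (intro conjI ballI impI)
    show "h ` P \<subseteq> carrier B" "h ` P \<noteq> {}"
      using A.ideal_closed[OF P(1)] A.ideal_zero[OF P(1)] by auto
    fix u v
    assume v: "v \<in> h ` P"
    then obtain y where y: "v = h y" "y \<in> P" and [simp]: "y \<in> carrier A"
      using A.ideal_closed[OF P(1)] by auto
    show "u \<in> h ` P" if u: "u \<in> carrier B" "mv_le B u v"
    proof -
      obtain x where x: "u = h x" and [simp]: "x \<in> carrier A"
        using u surj by auto
      have "u = h (mv_meet A x y)"
        using u x y by (simp add: B.meet_absorb)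
      moreover have "mv_meet A x y \<in> P"
        using y A.ideal_down[OF P(1) A.meet_lower(2)] by simp
      ultimately show ?thesis
        by blast
    qed
  next
    fix u v
    assume "u \<in> h ` P" "v \<in> h ` P"
    then obtain x y where "x \<in> P" "y \<in> P" "u = h x" "v = h y"
      by auto
    then have "u \<oplus>\<^bsub>B\<^esub> v = h (x \<oplus>\<^bsub>A\<^esub> y)" "x \<oplus>\<^bsub>A\<^esub> y \<in> P"
      using A.ideal_closed[OF P(1)] A.ideal_plus[OF P(1)] by auto
    then show "u \<oplus>\<^bsub>B\<^esub> v \<in> h ` P"
      by blast
  qed
  moreover have "h ` P \<noteq> carrier B"
  proof
    assume "h ` P = carrier B"
    then have "pull (h ` P) = carrier A"
      by (auto simp: pull_def)
    then show False
      using P pull_image by simp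
  qed
  moreover have "u \<in> h ` P \<or> v \<in> h ` P"
    if uv: "u \<in> carrier B" "v \<in> carrier B" "mv_meet B u v \<in> h ` P" for u v
  proof -
    obtain x y where xy: "u = h x" "v = h y" "x \<in> carrier A" "y \<in> carrier A"
      using uv surj by blast
    then have "mv_meet A x y \<in> P"
      using uv h_mem[of "mv_meet A x y"] by simp
    then show ?thesis
      using P(4) xy by blast
  qed
  ultimately show ?thesis
    by (simp add: mv_Spec_def mv_prime_def)
qed

text \<open>Image and preimage under \<open>h\<close> are inverse to each other and exchange the basic open sets
  given by \<open>a\<close> and by \<open>h a\<close>; as \<open>h\<close> is surjective, these are all basic open sets on
  both sides.\<close>

lemma V_kernel_homeomorphic_Spec:
  "subtopology (mv_zariski A) (mv_V A kernel) homeomorphic_space mv_zariski B"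
proof -
  let ?X = "subtopology (mv_zariski A) (mv_V A kernel)"
  have top [simp]: "topspace ?X = mv_V A kernel"
    by (auto simp: topspace_mv_zariski mv_V_def)
  have V: "mv_ideal A P" "kernel \<subseteq> P" if "P \<in> mv_V A kernel" for P
    using that by (auto simp: mv_V_def A.prime_ideal)
  have "continuous_map ?X (mv_zariski B) ((`) h)"
    unfolding mv_zariski_def[of B]
  proof (rule continuous_on_generated_topo)
    show "(`) h ` topspace ?X \<subseteq> \<Union> {{Q \<in> mv_Spec B. b \<notin> Q} |b. b \<in> carrier B}"
      unfolding top
      using image_in_Spec topspace_mv_zariski[of B] topology_generated_by_topspace
      by (fastforce simp: mv_zariski_def)
    fix U
    assume "U \<in> {{Q \<in> mv_Spec B. b \<notin> Q} |b. b \<in> carrier B}"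
    then obtain a where a: "a \<in> carrier A" "U = {Q \<in> mv_Spec B. h a \<notin> Q}"
      unfolding surj[symmetric] by auto
    have "h a \<in> h ` P \<longleftrightarrow> a \<in> P" if "P \<in> mv_V A kernel" for P
      using pull_image[OF V[OF that]] a(1) by (auto simp: pull_def)
    then have "(`) h -` U \<inter> topspace ?X = {P \<in> mv_Spec A. a \<notin> P} \<inter> mv_V A kernel"
      unfolding top a(2) using image_in_Spec by (auto simp: mv_V_def)
    then show "openin ?X ((`) h -` U \<inter> topspace ?X)"
      using A.openin_zariski_basic[OF a(1)] by (auto simp: openin_subtopology)
  qed
  moreover have "continuous_map (mv_zariski B) ?X pull"
    unfolding continuous_map_in_subtopology
  proof
    show "pull \<in> topspace (mv_zariski B) \<rightarrow> mv_V A kernel"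
      by (simp add: topspace_mv_zariski pull_in_V)
    show "continuous_map (mv_zariski B) (mv_zariski A) pull"
      unfolding mv_zariski_def[of A]
    proof (rule continuous_on_generated_topo)
      show "pull ` topspace (mv_zariski B) \<subseteq> \<Union> {{P \<in> mv_Spec A. a \<notin> P} |a. a \<in> carrier A}"
        using pull_in_V topspace_mv_zariski[of A] topology_generated_by_topspace
        by (fastforce simp: mv_zariski_def[of A] topspace_mv_zariski mv_V_def)
      fix U
      assume "U \<in> {{P \<in> mv_Spec A. a \<notin> P} |a. a \<in> carrier A}"
      then obtain a where a: "a \<in> carrier A" "U = {P \<in> mv_Spec A. a \<notin> P}"
        by auto
      have "pull -` U \<inter> topspace (mv_zariski B) = {Q \<in> mv_Spec B. h a \<notin> Q}"
        unfolding a(2) topspace_mv_zariski using a(1) pull_in_V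
        by (auto simp: pull_def mv_V_def)
      then show "openin (mv_zariski B) (pull -` U \<inter> topspace (mv_zariski B))"
        using B.openin_zariski_basic[of "h a"] a(1) by simp
    qed
  qed
  moreover have "h ` pull Q = Q" if "Q \<in> mv_Spec B" for Q
    using B.ideal_closed[OF B.prime_ideal[OF that]] by (intro image_pull) auto
  ultimately have "homeomorphic_maps ?X (mv_zariski B) ((`) h) pull"
    using pull_image[OF V] by (simp add: homeomorphic_maps_def topspace_mv_zariski)
  then show ?thesis
    unfolding homeomorphic_space_def by blast
qed

end

lemma mv_algebra_surjective_image:
  assumes A: "mv_algebra A" and h: "h \<in> mv_hom A B" and surj: "h ` carrier A = carrier B"
  shows "mv_algebra B"
proof -
  interpret A: mv_algebra A by (rule A)
  have [simp]: "h x \<oplus>\<^bsub>B\<^esub> h y = h (x \<oplus>\<^bsub>A\<^esub> y)" "\<sim>\<^bsub>B\<^esub> h x = h (\<sim>\<^bsub>A\<^esub> x)"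
    if "x \<in> carrier A" "y \<in> carrier A" for x y
    using h that by (auto simp: mv_hom_def)
  have [simp]: "\<zero>\<^bsub>B\<^esub> = h \<zero>\<^bsub>A\<^esub>"
    using h by (auto simp: mv_hom_def)
  show ?thesis
  proof (rule mv_algebra.intro)
    show "comm_monoid \<lparr>carrier = carrier B, monoid.mult = mv_plus B, one = \<zero>\<^bsub>B\<^esub>\<rparr>"
      by (rule comm_monoidI) (auto simp flip: surj simp: A.plus_ac)
  qed (auto simp flip: surj simp: A.lukasiewicz)
qed

context mv_algebra
begin

text \<open>The order of the quotient \<open>A/J\<close>, read on representatives. As a preorder it is easier to
  handle than the congruence itself: each compatibility needs to be checked in one direction
  only.\<close>

definition le_mod :: "'a set \<Rightarrow> 'a \<Rightarrow> 'a \<Rightarrow> bool" where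
  "le_mod J x y \<longleftrightarrow> (\<exists>j\<in>J. x \<preceq> y \<oplus> j)"

definition eq_mod :: "'a set \<Rightarrow> 'a \<Rightarrow> 'a \<Rightarrow> bool" where
  "eq_mod J x y \<longleftrightarrow> le_mod J x y \<and> le_mod J y x"

definition rep :: "'a set \<Rightarrow> 'a \<Rightarrow> 'a" where
  "rep J x = (SOME y. y \<in> carrier A \<and> eq_mod J x y)"

text \<open>The quotient \<open>A/J\<close> on a system of representatives instead of the set of cosets, so that
  its elements have the same type as those of \<open>A\<close>. The type of a local MV-algebra with a given
  spectrum is thereby that of \<open>A\<close>.\<close>

definition quot :: "'a set \<Rightarrow> 'a mv_algebra" where
  "quot J = \<lparr>carrier = rep J ` carrier A, mv_plus = (\<lambda>x y. rep J (x \<oplus> y)),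
     mv_zero = rep J \<zero>, mv_neg = (\<lambda>x. rep J (\<sim> x))\<rparr>"

context
  fixes J assumes J: "mv_ideal A J"
begin

lemma le_mod_refl: "x \<in> carrier A \<Longrightarrow> le_mod J x x"
  unfolding le_mod_def using ideal_zero[OF J] by (intro bexI[of _ \<zero>]) simp_all

lemma le_mod_plus:
  assumes "le_mod J x y" "le_mod J x' y'"
    and [simp]: "x \<in> carrier A" "x' \<in> carrier A" "y \<in> carrier A" "y' \<in> carrier A"
  shows "le_mod J (x \<oplus> x') (y \<oplus> y')"
proof -
  obtain i j where ij: "i \<in> J" "j \<in> J" "x \<preceq> y \<oplus> i" "x' \<preceq> y' \<oplus> j"
    using assms by (auto simp: le_mod_def)
  have [simp]: "i \<in> carrier A" "j \<in> carrier A"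
    using ij ideal_closed[OF J] by simp_all
  have "x \<oplus> x' \<preceq> (y \<oplus> i) \<oplus> (y' \<oplus> j)"
    using ij by (intro plus_mono) simp_all
  also have "\<dots> = (y \<oplus> y') \<oplus> (i \<oplus> j)"
    by (simp add: plus_ac)
  finally show ?thesis
    using ij ideal_plus[OF J] by (auto simp: le_mod_def)
qed

lemma le_mod_trans:
  assumes "le_mod J x y" "le_mod J y z"
    and [simp]: "x \<in> carrier A" "y \<in> carrier A" "z \<in> carrier A"
  shows "le_mod J x z"
proof -
  obtain i j where ij: "i \<in> J" "j \<in> J" "x \<preceq> y \<oplus> i" "y \<preceq> z \<oplus> j"
    using assms by (auto simp: le_mod_def)
  have [simp]: "i \<in> carrier A" "j \<in> carrier A"
    using ij ideal_closed[OF J] by simp_all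
  have "y \<oplus> i \<preceq> z \<oplus> (j \<oplus> i)"
    using plus_mono[OF ij(4) le_refl[of i]] by (simp add: plus_assoc)
  then have "x \<preceq> z \<oplus> (j \<oplus> i)"
    using ij(3) le_trans[of x "y \<oplus> i"] by simp
  then show ?thesis
    using ij ideal_plus[OF J] by (auto simp: le_mod_def)
qed

lemma le_mod_neg:
  assumes "le_mod J x y" and [simp]: "x \<in> carrier A" "y \<in> carrier A"
  shows "le_mod J (\<sim> y) (\<sim> x)"
proof -
  obtain j where j: "j \<in> J" "x \<preceq> y \<oplus> j"
    using assms by (auto simp: le_mod_def)
  moreover have "j \<in> carrier A"
    using j ideal_closed[OF J] by simp
  ultimately have "\<sim> y \<preceq> \<sim> x \<oplus> j"
    by (simp add: le_iff plus_left_comm)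
  then show ?thesis
    using j by (auto simp: le_mod_def)
qed

lemma
  assumes x: "x \<in> carrier A"
  shows rep_closed: "rep J x \<in> carrier A" and eq_mod_rep: "eq_mod J x (rep J x)"
proof -
  have "rep J x \<in> carrier A \<and> eq_mod J x (rep J x)"
    unfolding rep_def by (rule someI[of _ x]) (simp add: x eq_mod_def le_mod_refl)
  then show "rep J x \<in> carrier A" "eq_mod J x (rep J x)"
    by simp_all
qed

lemma rep_eq_iff:
  assumes "x \<in> carrier A" "y \<in> carrier A"
  shows "rep J x = rep J y \<longleftrightarrow> eq_mod J x y"
proof
  have trans: "eq_mod J u w" if "eq_mod J u v" "eq_mod J v w"
    "u \<in> carrier A" "v \<in> carrier A" "w \<in> carrier A" for u v w
    using that le_mod_trans by (meson eq_mod_def)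
  have sym: "eq_mod J u v \<longleftrightarrow> eq_mod J v u" for u v
    by (auto simp: eq_mod_def)
  show "eq_mod J x y" if "rep J x = rep J y"
    using that rep_closed eq_mod_rep assms sym trans by metis
  assume "eq_mod J x y"
  \<comment> \<open>Congruent elements have the same congruents, so the choice is made from the same set.\<close>
  then have "eq_mod J x z \<longleftrightarrow> eq_mod J y z" if "z \<in> carrier A" for z
    using that assms trans sym by blast
  then show "rep J x = rep J y"
    unfolding rep_def by metis
qed

lemma rep_hom: "rep J \<in> mv_hom A (quot J)"
proof -
  have "rep J (x \<oplus> y) = rep J (rep J x \<oplus> rep J y)" if "x \<in> carrier A" "y \<in> carrier A" for x y
    using that rep_closed eq_mod_rep[of x] eq_mod_rep[of y]
    by (subst rep_eq_iff) (auto simp: eq_mod_def intro: le_mod_plus)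
  moreover have "rep J (\<sim> x) = rep J (\<sim> (rep J x))" if "x \<in> carrier A" for x
    using that rep_closed eq_mod_rep[of x]
    by (subst rep_eq_iff) (auto simp: eq_mod_def intro: le_mod_neg)
  ultimately show ?thesis
    by (auto simp: mv_hom_def quot_def)
qed

lemma mv_surjection_rep: "mv_surjection A (quot J) (rep J)"
proof -
  have surj: "rep J ` carrier A = carrier (quot J)"
    by (simp add: quot_def)
  then show ?thesis
    using mv_algebra_axioms mv_algebra_surjective_image[OF mv_algebra_axioms rep_hom surj] rep_hom
    by (simp add: mv_surjection_def mv_surjection_axioms_def)
qed

lemma kernel_rep: "mv_surjection.kernel A (quot J) (rep J) = J"
proof -
  have "rep J x = rep J \<zero> \<longleftrightarrow> x \<in> J" if [simp]: "x \<in> carrier A" for x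
  proof -
    have "le_mod J \<zero> x"
      unfolding le_mod_def using ideal_zero[OF J] by (intro bexI[of _ \<zero>]) simp_all
    then have "rep J x = rep J \<zero> \<longleftrightarrow> (\<exists>j\<in>J. x \<preceq> j)"
      using ideal_closed[OF J] by (auto simp: rep_eq_iff eq_mod_def le_mod_def)
    then show ?thesis
      using ideal_down[OF J] le_refl[of x] that by blast
  qed
  moreover have "\<zero>\<^bsub>quot J\<^esub> = rep J \<zero>"
    by (simp add: quot_def)
  ultimately show ?thesis
    using ideal_closed[OF J] by (auto simp: mv_surjection.kernel_def[OF mv_surjection_rep])
qed

end

lemma V_homeomorphic_Spec_quot:
  assumes "mv_ideal A J"
  shows "subtopology (mv_zariski A) (mv_V A J) homeomorphic_space mv_zariski (quot J)"
  using mv_surjection.V_kernel_homeomorphic_Spec[OF mv_surjection_rep[OF assms]]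
  by (simp add: kernel_rep[OF assms])

end

section \<open>The equivalences\<close>

lemma one_closed_point_homeomorphic:
  assumes "X homeomorphic_space Y" "one_closed_point X"
  shows "one_closed_point Y"
proof -
  obtain f g where fg: "homeomorphic_maps X Y f g"
    using assms(1) by (auto simp: homeomorphic_space_def)
  then have f: "homeomorphic_map X Y f" and g: "homeomorphic_map Y X g"
    using homeomorphic_maps_map by blast+
  have inv: "\<And>x. x \<in> topspace X \<Longrightarrow> f x \<in> topspace Y \<and> g (f x) = x"
    "\<And>y. y \<in> topspace Y \<Longrightarrow> g y \<in> topspace X \<and> f (g y) = y"
    using fg by (auto simp: homeomorphic_maps_def continuous_map_def)
  have "closedin Y {f x}" if "closedin X {x}" for x
    using homeomorphic_map_closedness_eq[OF f, of "{x}"] that closedin_subset by auto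
  moreover have "closedin X {g y}" if "closedin Y {y}" for y
    using homeomorphic_map_closedness_eq[OF g, of "{y}"] that closedin_subset by auto
  ultimately show ?thesis
    using assms(2) inv unfolding one_closed_point_def by metis
qed

lemma local_spectrum_imp_one_closed_point:
  assumes "is_local_spectrum TYPE('b) X"
  shows "one_closed_point X"
proof -
  obtain B :: "'b mv_algebra" where B: "mv_local B" "X homeomorphic_space mv_zariski B"
    using assms by (auto simp: is_local_spectrum_def)
  then have "one_closed_point (mv_zariski B)"
    using mv_algebra.local_iff_one_closed_point by (auto simp: mv_local_def)
  then show ?thesis
    using one_closed_point_homeomorphic B(2) homeomorphic_space_sym by blast
qed

lemma (in mv_algebra) one_closed_point_imp_local_spectrum:
  assumes I: "I \<subseteq> carrier A"
    and one: "one_closed_point (subtopology (mv_zariski A) (mv_V A I))"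
  shows "is_local_spectrum TYPE('a) (subtopology (mv_zariski A) (mv_V A I))"
proof -
  let ?J = "mv_Inter A (mv_V A I)"
  have homeo: "subtopology (mv_zariski A) (mv_V A I) homeomorphic_space mv_zariski (quot ?J)"
    using V_homeomorphic_Spec_quot[OF ideal_Inter_V, of I] by (simp add: V_Inter_V[OF I])
  interpret Q: mv_algebra "quot ?J"
    using mv_surjection_rep[OF ideal_Inter_V] by (simp add: mv_surjection_def)
  have "mv_local (quot ?J)"
    using one_closed_point_homeomorphic[OF homeo one] by (simp add: Q.local_iff_one_closed_point)
  then show ?thesis
    using homeo by (auto simp: is_local_spectrum_def)
qed

text \<open>Both implications from local algebras are instances of
  \<open>local_spectrum_imp_one_closed_point\<close>, which holds for every type of elements. The way back
  lands in the element type of \<open>free_mv K\<close>, since the quotient is formed there.\<close>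

theorem theorem8p7:
  fixes K :: "'k set" and I :: "'k mv_term set set" and C :: "'k mv_term set set set"
    and X :: "'k mv_term set set topology"
  assumes "I \<subseteq> carrier (free_mv K)"
    and "C = mv_V (free_mv K) I"
    and "X = subtopology (mv_zariski (free_mv K)) C"
  shows "(is_local_spectrum TYPE('k mv_term set) X \<longleftrightarrow> one_closed_point X)
       \<and> (one_closed_point X \<longleftrightarrow> mv_primary (free_mv K) (mv_Inter (free_mv K) C))
       \<and> (is_local_spectrum TYPE('b) X \<longrightarrow> is_local_spectrum TYPE('k mv_term set) X)"
proof -
  interpret F: mv_algebra "free_mv K"
    by (rule mv_algebra_free_mv)
  have "one_closed_point X \<Longrightarrow> is_local_spectrum TYPE('k mv_term set) X"
    using F.one_closed_point_imp_local_spectrum assms by simp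
  moreover have "one_closed_point X \<longleftrightarrow> mv_primary (free_mv K) (mv_Inter (free_mv K) C)"
    using F.one_closed_point_iff_primary assms by simp
  ultimately show ?thesis
    using local_spectrum_imp_one_closed_point[where 'b = "'k mv_term set" and X = X]
      local_spectrum_imp_one_closed_point[where 'b = 'b and X = X] by blast
qed

end
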